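(* Let $A$ be a finite-dimensional $n$-Lie algebra over a field $\mathbf{F}$ of characteristic zero. Then $A$ is an $E$-algebra if and only if the quotient $n$-Lie algebra $A/\Phi(A)$ is elementary.
   Context: An $n$-Lie algebra ($n\ge 2$) over a field $\mathbf{F}$ is a vector space $A$ over $\mathbf{F}$ with an $n$-ary multilinear operation $[\,,\dots,\,]$ satisfying $[x_1,\dots,x_n]=\operatorname{sgn}(\sigma)[x_{\sigma(1)},\dots,x_{\sigma(n)}]$ for all $\sigma\in S_n$ and $[[x_1,\dots,x_n],y_2,\dots,y_n]=\sum_{i=1}^n[x_1,\dots,[x_i,y_2,\dots,y_n],\dots,x_n]$. A subalgebra is a subspace $B$ with $[B,\dots,B]\subseteq B$; an ideal is a subspace $I$ with $[I,A,\dots,A]\subseteq I$. A proper subalgebra $M$ is maximal if the only subalgebra properly containing $M$ is $A$ itself. The Frattini subalgebra $F(A)$ is the intersection of all maximal subalgebras of $A$ (with $F(0)=0$), and $\Phi(A)$ is the largest ideal of $A$ contained in $F(A)$. An $n$-Lie algebra $L$ is elementary if $\Phi(C)=0$ for every subalgebra $C$ of $L$ (including $L$ itself). $A$ is an $E$-algebra if $\Phi(B)\subseteq\Phi(A)$ for all subalgebras $B$ of $A$. *)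

theory Defs
  imports
    "HOL-Combinatorics.Permutations"
    "HOL-Algebra.QuotRing"
    "Jordan_Normal_Form.Missing_VectorSpace"
begin

locale field_characteristic_zero = field F for F (structure) +
  assumes characteristic_zero: "\<And>k :: nat. k > 0 \<Longrightarrow> [k] \<cdot> \<one> \<noteq> \<zero>"

text \<open>
  The bracket is applied to lists; only its values on lists of length \<open>n\<close> with entries in the
  carrier matter.  The fields \<open>mult\<close> and \<open>one\<close>, inherited from the ring record through the module
  record, play no role.
\<close>

record ('f, 'a) nLie = "('f, 'a) module" +
  bracket :: "'a list \<Rightarrow> 'a"

locale nLie_algebra = vectorspace F A
  for n :: nat and F :: "('f, 'k) ring_scheme" and A :: "('f, 'a, 'm) nLie_scheme" +
  assumes arity: "n \<ge> 2"
    and bracket_closed: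
      "\<lbrakk>length xs = n; set xs \<subseteq> carrier A\<rbrakk> \<Longrightarrow> bracket A xs \<in> carrier A"
    and bracket_add:
      "\<lbrakk>length xs = n; set xs \<subseteq> carrier A; i < n; x \<in> carrier A; y \<in> carrier A\<rbrakk> \<Longrightarrow>
        bracket A (xs[i := x \<oplus>\<^bsub>A\<^esub> y]) = bracket A (xs[i := x]) \<oplus>\<^bsub>A\<^esub> bracket A (xs[i := y])"
    and bracket_smult:
      "\<lbrakk>length xs = n; set xs \<subseteq> carrier A; i < n; c \<in> carrier F; x \<in> carrier A\<rbrakk> \<Longrightarrow>
        bracket A (xs[i := c \<odot>\<^bsub>A\<^esub> x]) = c \<odot>\<^bsub>A\<^esub> bracket A (xs[i := x])"
    and bracket_skew:
      "\<lbrakk>length xs = n; set xs \<subseteq> carrier A; \<sigma> permutes {..<n}\<rbrakk> \<Longrightarrow>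
        bracket A xs = [sign \<sigma>] \<cdot>\<^bsub>A\<^esub> bracket A (permute_list \<sigma> xs)"
    and bracket_derivation:
      "\<lbrakk>length xs = n; set xs \<subseteq> carrier A; length ys = n - 1; set ys \<subseteq> carrier A\<rbrakk> \<Longrightarrow>
        bracket A (bracket A xs # ys) =
          (\<Oplus>\<^bsub>A\<^esub>i\<in>{..<n}. bracket A (xs[i := bracket A (xs ! i # ys)]))"

definition nLie_subalgebra ::
  "nat \<Rightarrow> ('f, 'k) ring_scheme \<Rightarrow> ('f, 'a, 'm) nLie_scheme \<Rightarrow> 'a set \<Rightarrow> bool" where
  "nLie_subalgebra n F A B \<longleftrightarrow>
     subspace F B A \<and> (\<forall>xs. length xs = n \<and> set xs \<subseteq> B \<longrightarrow> bracket A xs \<in> B)"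

definition nLie_ideal ::
  "nat \<Rightarrow> ('f, 'k) ring_scheme \<Rightarrow> ('f, 'a, 'm) nLie_scheme \<Rightarrow> 'a set \<Rightarrow> bool" where
  "nLie_ideal n F A I \<longleftrightarrow>
     subspace F I A \<and>
     (\<forall>x ys. x \<in> I \<and> length ys = n - 1 \<and> set ys \<subseteq> carrier A \<longrightarrow> bracket A (x # ys) \<in> I)"

definition nLie_maximal_subalgebra ::
  "nat \<Rightarrow> ('f, 'k) ring_scheme \<Rightarrow> ('f, 'a, 'm) nLie_scheme \<Rightarrow> 'a set \<Rightarrow> bool" where
  "nLie_maximal_subalgebra n F A M \<longleftrightarrow>
     nLie_subalgebra n F A M \<and> M \<noteq> carrier A \<and>
     (\<forall>B. nLie_subalgebra n F A B \<and> M \<subset> B \<longrightarrow> B = carrier A)"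

text \<open>
  The intersection is taken inside \<open>A\<close>, so it is \<open>A\<close> if there are no maximal subalgebras; among
  finite-dimensional algebras this happens only for the zero algebra, where it gives
  the convention \<open>F(0) = 0\<close>.
\<close>

definition Frattini_subalgebra ::
  "nat \<Rightarrow> ('f, 'k) ring_scheme \<Rightarrow> ('f, 'a, 'm) nLie_scheme \<Rightarrow> 'a set" where
  "Frattini_subalgebra n F A = carrier A \<inter> \<Inter> {M. nLie_maximal_subalgebra n F A M}"

text \<open>The order on sets is inclusion. The greatest element exists because a sum of ideals is an
  ideal and the Frattini subalgebra is a subspace.\<close>

definition Frattini_ideal ::
  "nat \<Rightarrow> ('f, 'k) ring_scheme \<Rightarrow> ('f, 'a, 'm) nLie_scheme \<Rightarrow> 'a set" where
  "Frattini_ideal n F A = (GREATEST I. nLie_ideal n F A I \<and> I \<subseteq> Frattini_subalgebra n F A)"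

text \<open>A subalgebra \<open>B\<close> of \<open>A\<close>, regarded as an algebra in its own right, is \<open>A\<lparr>carrier := B\<rparr>\<close>.\<close>

definition nLie_elementary ::
  "nat \<Rightarrow> ('f, 'k) ring_scheme \<Rightarrow> ('f, 'a, 'm) nLie_scheme \<Rightarrow> bool" where
  "nLie_elementary n F L \<longleftrightarrow>
     nLie_algebra n F L \<and>
     (\<forall>C. nLie_subalgebra n F L C \<longrightarrow> Frattini_ideal n F (L\<lparr>carrier := C\<rparr>) = {\<zero>\<^bsub>L\<^esub>})"

definition nLie_E_algebra ::
  "nat \<Rightarrow> ('f, 'k) ring_scheme \<Rightarrow> ('f, 'a, 'm) nLie_scheme \<Rightarrow> bool" where
  "nLie_E_algebra n F A \<longleftrightarrow>
     nLie_algebra n F A \<and>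
     (\<forall>B. nLie_subalgebra n F A B \<longrightarrow>
        Frattini_ideal n F (A\<lparr>carrier := B\<rparr>) \<subseteq> Frattini_ideal n F A)"

text \<open>
  The elements of \<open>A/I\<close> are the cosets of \<open>I\<close>. As in \<^const>\<open>rcoset_mult\<close>, an operation on cosets
  is the union of the (equal) cosets obtained from all choices of representatives;
  \<^term>\<open>listset Xs\<close> is the set of lists of representatives of the list \<open>Xs\<close> of cosets.
  The fields \<open>mult\<close> and \<open>one\<close> are filled in as in \<^const>\<open>FactRing\<close>.
\<close>

definition nLie_quotient :: "('f, 'a, 'm) nLie_scheme \<Rightarrow> 'a set \<Rightarrow> ('f, 'a set) nLie" where
  "nLie_quotient A I =
    \<lparr>carrier = a_rcosets\<^bsub>A\<^esub> I,
     mult = rcoset_mult A I,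
     one = I +>\<^bsub>A\<^esub> \<one>\<^bsub>A\<^esub>,
     zero = I,
     add = set_add A,
     smult = (\<lambda>c X. \<Union>x\<in>X. I +>\<^bsub>A\<^esub> (c \<odot>\<^bsub>A\<^esub> x)),
     bracket = (\<lambda>Xs. \<Union>xs\<in>listset Xs. I +>\<^bsub>A\<^esub> bracket A xs)\<rparr>"

end

theory Submission
  imports Defs
begin

text \<open>
  Everything rests on how the Frattini ideal behaves under a surjective homomorphism
  \<open>f : A \<rightarrow> L\<close> of n-Lie algebras. The preimage of a maximal subalgebra of \<open>L\<close> is a maximal
  subalgebra of \<open>A\<close>; hence \<open>f\<close> maps \<open>\<Phi>(A)\<close>, an ideal inside every maximal subalgebra of \<open>A\<close>, to an
  ideal inside every maximal subalgebra of \<open>L\<close>, that is, \<open>f(\<Phi>(A)) \<subseteq> \<Phi>(L)\<close>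
  (\<open>image_Frattini_ideal\<close>). In the other direction, the preimage of \<open>\<Phi>(L)\<close> contains the
  kernel and need not lie in \<open>\<Phi>(A)\<close>, because a maximal subalgebra of \<open>A\<close> can map onto \<open>L\<close>. It does
  as soon as no proper subalgebra of \<open>A\<close> maps onto \<open>L\<close>:
  then taking images and preimages matches the maximal subalgebras of \<open>A\<close> with some of those of
  \<open>L\<close>, so the preimage of \<open>\<Phi>(L)\<close> is an ideal contained in every maximal subalgebra of \<open>A\<close>,
  that is, in \<open>\<Phi>(A)\<close> (\<open>preimage_Frattini_ideal_if_essential\<close>).

  Both statements are applied to restrictions of the quotient map \<open>\<pi> : A \<rightarrow> A/\<Phi>(A)\<close>. If the
  quotient is elementary and \<open>B\<close> is a subalgebra of \<open>A\<close>, then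
  \<open>\<pi>(\<Phi>(B)) \<subseteq> \<Phi>(\<pi>(B)) = 0\<close>, so \<open>\<Phi>(B)\<close> lies in the kernel \<open>\<Phi>(A)\<close>. Conversely let \<open>A\<close> be an
  E-algebra and \<open>C\<close> a subalgebra of the quotient. Finite dimension supplies a subalgebra \<open>D\<close> of
  \<open>A\<close> that is minimal among those mapping onto \<open>C\<close> (\<open>minimal_subspace_exists\<close>). By the second
  statement every preimage in \<open>D\<close> of an element of \<open>\<Phi>(C)\<close> lies in \<open>\<Phi>(D) \<subseteq> \<Phi>(A)\<close>, the kernel, so
  \<open>\<Phi>(C) = 0\<close>.
\<close>

section \<open>Sums, signs and descending chains of subspaces\<close>

lemma finsum_additive_image:
  assumes G: "abelian_monoid G" and H: "abelian_monoid H"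
    and f: "\<And>x. x \<in> carrier G \<Longrightarrow> f x \<in> carrier H"
    and f_add: "\<And>x y. \<lbrakk>x \<in> carrier G; y \<in> carrier G\<rbrakk> \<Longrightarrow> f (x \<oplus>\<^bsub>G\<^esub> y) = f x \<oplus>\<^bsub>H\<^esub> f y"
    and f_zero: "f \<zero>\<^bsub>G\<^esub> = \<zero>\<^bsub>H\<^esub>"
    and g: "\<And>i. i \<in> S \<Longrightarrow> g i \<in> carrier G"
  shows "f (\<Oplus>\<^bsub>G\<^esub>i\<in>S. g i) = (\<Oplus>\<^bsub>H\<^esub>i\<in>S. f (g i))"
proof -
  interpret G: abelian_monoid G by (rule G)
  interpret H: abelian_monoid H by (rule H)
  show ?thesis
    using g
  proof (induction S rule: infinite_finite_induct)
    case (insert i S)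
    then have "f (\<Oplus>\<^bsub>G\<^esub>i\<in>insert i S. g i) = f (g i \<oplus>\<^bsub>G\<^esub> (\<Oplus>\<^bsub>G\<^esub>i\<in>S. g i))"
      by (subst G.finsum_insert) auto
    also have "\<dots> = f (g i) \<oplus>\<^bsub>H\<^esub> (\<Oplus>\<^bsub>H\<^esub>i\<in>S. f (g i))"
      using insert by (subst f_add) (auto intro!: G.finsum_closed)
    also have "\<dots> = (\<Oplus>\<^bsub>H\<^esub>i\<in>insert i S. f (g i))"
      using insert f by (subst H.finsum_insert) auto
    finally show ?case .
  qed (auto simp: f_zero)
qed

text \<open>
  Integer multiples involve the additive inverse, which is defined by a choice from the carrier.
  Scalar multiples are unaffected by a change of carrier and are respected by linear maps, so in
  this form skew symmetry passes to subalgebras and to images.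
\<close>

lemma (in module) add_pow_sign:
  assumes "x \<in> carrier M"
  shows "[sign \<sigma>] \<cdot>\<^bsub>M\<^esub> x = (if sign \<sigma> = 1 then \<one> else \<ominus> \<one>) \<odot>\<^bsub>M\<^esub> x"
proof (cases "sign \<sigma> = 1")
  case True
  then show ?thesis
    using assms by (simp add: add_pow_def int_pow_def nat_pow_def)
next
  case False
  then have "sign \<sigma> = -1"
    by (simp add: sign_def split: if_splits)
  moreover have "[(-1 :: int)] \<cdot>\<^bsub>M\<^esub> x = \<ominus>\<^bsub>M\<^esub> x"
    using assms add_pow_int_lt[of "-1" M x] by (simp add: add_pow_def nat_pow_def)
  ultimately show ?thesis
    using assms by (simp add: smult_l_minus)
qed

text \<open>
  Choose a member of the family whose independent subsets are as small as possible: its dimension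
  \<open>k\<close> is least. A member properly inside it would still contain \<open>k\<close> independent vectors, and adding
  a vector outside its span would give \<open>k + 1\<close> independent vectors in the chosen member.
\<close>

lemma (in vectorspace) minimal_subspace_exists:
  assumes fin: fin_dim and W0: "W0 \<in> \<W>" and sub: "\<And>W. W \<in> \<W> \<Longrightarrow> subspace K W V"
  obtains W where "W \<in> \<W>" "\<And>W'. \<lbrakk>W' \<in> \<W>; W' \<subseteq> W\<rbrakk> \<Longrightarrow> W' = W"
proof -
  have carr: "W \<subseteq> carrier V" if "W \<in> \<W>" for W
    using submodule.subset[OF subspace.submod[OF sub[OF that]]] .
  define P where "P k \<longleftrightarrow> (\<exists>W\<in>\<W>. \<forall>S\<subseteq>W. lin_indpt S \<longrightarrow> card S \<le> k)" for k
  have "P dim"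
    unfolding P_def
  proof (intro bexI[OF _ W0] allI impI)
    fix S assume "S \<subseteq> W0" "lin_indpt S"
    then show "card S \<le> dim" using carr[OF W0] by (intro li_le_dim(2)[OF fin]) blast+
  qed
  then have least: "P (LEAST k. P k)" by (rule LeastI)
  define k where "k = (LEAST k. P k)"
  obtain W where W: "W \<in> \<W>" and bound: "\<And>S. \<lbrakk>S \<subseteq> W; lin_indpt S\<rbrakk> \<Longrightarrow> card S \<le> k"
    using least unfolding P_def k_def by blast
  have "W' = W" if W': "W' \<in> \<W>" "W' \<subseteq> W" for W'
  proof (rule ccontr)
    assume "W' \<noteq> W"
    then obtain x where x: "x \<in> W" "x \<notin> W'" using W'(2) by blast
    have "\<exists>S\<subseteq>W'. lin_indpt S \<and> card S \<ge> k"
    proof (cases k)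
      case 0
      moreover have "lin_indpt {}" by (auto simp: lin_dep_def)
      ultimately show ?thesis by auto
    next
      case (Suc j)
      then have "\<not> P j" unfolding k_def by (metis lessI not_less_Least)
      then show ?thesis unfolding P_def Suc using W' by (meson not_less_eq_eq)
    qed
    then obtain S where S: "S \<subseteq> W'" "lin_indpt S" "card S \<ge> k" by blast
    have SV: "S \<subseteq> carrier V" and xV: "x \<in> carrier V" using S x W W' carr by blast+
    have finS: "finite S" by (rule li_le_dim(1)[OF fin SV S(2)])
    have "span S \<subseteq> W'"
      using span_is_subset[OF S(1) subspace.submod[OF sub[OF W'(1)]]] .
    then have "x \<notin> span S" and "x \<notin> S" using x S by blast+
    then have "lin_indpt (S \<union> {x})"
      using lin_dep_iff_in_span[OF SV S(2) xV] by blast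
    moreover have "S \<union> {x} \<subseteq> W" using S(1) W'(2) x(1) by blast
    ultimately have "card (S \<union> {x}) \<le> k" by (intro bound)
    then show False using finS \<open>x \<notin> S\<close> S(3) by simp
  qed
  with W that show ?thesis by blast
qed

section \<open>Subalgebras and ideals\<close>

context nLie_algebra
begin

lemma subspace_iff:
  "subspace F W A \<longleftrightarrow> W \<subseteq> carrier A \<and> \<zero>\<^bsub>A\<^esub> \<in> W \<and> (\<forall>x\<in>W. \<forall>y\<in>W. x \<oplus>\<^bsub>A\<^esub> y \<in> W)
     \<and> (\<forall>c\<in>carrier F. \<forall>x\<in>W. c \<odot>\<^bsub>A\<^esub> x \<in> W)"
  unfolding subspace_def submodule_def
  using vectorspace_axioms module_axioms by auto

lemma subalgebraI:
  assumes "B \<subseteq> carrier A" "\<zero>\<^bsub>A\<^esub> \<in> B" "\<And>x y. \<lbrakk>x \<in> B; y \<in> B\<rbrakk> \<Longrightarrow> x \<oplus>\<^bsub>A\<^esub> y \<in> B"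
    "\<And>c x. \<lbrakk>c \<in> carrier F; x \<in> B\<rbrakk> \<Longrightarrow> c \<odot>\<^bsub>A\<^esub> x \<in> B"
    "\<And>xs. \<lbrakk>length xs = n; set xs \<subseteq> B\<rbrakk> \<Longrightarrow> bracket A xs \<in> B"
  shows "nLie_subalgebra n F A B"
  using assms unfolding nLie_subalgebra_def subspace_iff by auto

lemma subalgebraD:
  assumes "nLie_subalgebra n F A B"
  shows "B \<subseteq> carrier A" "\<zero>\<^bsub>A\<^esub> \<in> B" "\<And>x y. \<lbrakk>x \<in> B; y \<in> B\<rbrakk> \<Longrightarrow> x \<oplus>\<^bsub>A\<^esub> y \<in> B"
    "\<And>c x. \<lbrakk>c \<in> carrier F; x \<in> B\<rbrakk> \<Longrightarrow> c \<odot>\<^bsub>A\<^esub> x \<in> B"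
    "\<And>xs. \<lbrakk>length xs = n; set xs \<subseteq> B\<rbrakk> \<Longrightarrow> bracket A xs \<in> B"
  using assms unfolding nLie_subalgebra_def subspace_iff by auto

lemma idealI:
  assumes "I \<subseteq> carrier A" "\<zero>\<^bsub>A\<^esub> \<in> I" "\<And>x y. \<lbrakk>x \<in> I; y \<in> I\<rbrakk> \<Longrightarrow> x \<oplus>\<^bsub>A\<^esub> y \<in> I"
    "\<And>c x. \<lbrakk>c \<in> carrier F; x \<in> I\<rbrakk> \<Longrightarrow> c \<odot>\<^bsub>A\<^esub> x \<in> I"
    "\<And>x ys. \<lbrakk>x \<in> I; length ys = n - 1; set ys \<subseteq> carrier A\<rbrakk> \<Longrightarrow> bracket A (x # ys) \<in> I"
  shows "nLie_ideal n F A I"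
  using assms unfolding nLie_ideal_def subspace_iff by auto

lemma idealD:
  assumes "nLie_ideal n F A I"
  shows "I \<subseteq> carrier A" "\<zero>\<^bsub>A\<^esub> \<in> I" "\<And>x y. \<lbrakk>x \<in> I; y \<in> I\<rbrakk> \<Longrightarrow> x \<oplus>\<^bsub>A\<^esub> y \<in> I"
    "\<And>c x. \<lbrakk>c \<in> carrier F; x \<in> I\<rbrakk> \<Longrightarrow> c \<odot>\<^bsub>A\<^esub> x \<in> I"
    "\<And>x ys. \<lbrakk>x \<in> I; length ys = n - 1; set ys \<subseteq> carrier A\<rbrakk> \<Longrightarrow> bracket A (x # ys) \<in> I"
  using assms unfolding nLie_ideal_def subspace_iff by auto

lemma subalgebra_is_nLie_algebra:
  assumes B: "nLie_subalgebra n F A B"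
  shows "nLie_algebra n F (A\<lparr>carrier := B\<rparr>)"
proof -
  note B' = subalgebraD[OF B]
  have sub: "subspace F B A" using B by (simp add: nLie_subalgebra_def)
  interpret B: vectorspace F "A\<lparr>carrier := B\<rparr>" by (rule subspace_is_vs[OF sub])
  have fs: "(\<Oplus>\<^bsub>A\<lparr>carrier := B\<rparr>\<^esub>i\<in>S. g i) = (\<Oplus>\<^bsub>A\<^esub>i\<in>S. g i)"
    if "\<And>i. i \<in> S \<Longrightarrow> g i \<in> B" for S :: "nat set" and g
    using finsum_additive_image[where f = "\<lambda>x. x" and g = g and S = S, OF B.abelian_monoid_axioms M.abelian_monoid_axioms]
      that B' by auto
  have upd: "set (xs[i := x]) \<subseteq> B" if "set xs \<subseteq> B" "x \<in> B" for xs i x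
    using that set_update_subset_insert[of xs i x] by blast
  show ?thesis
  proof
    show "n \<ge> 2" by (rule arity)
  next
    fix xs :: "'a list" and i x y
    assume "length xs = n" "set xs \<subseteq> carrier (A\<lparr>carrier := B\<rparr>)" "i < n"
      "x \<in> carrier (A\<lparr>carrier := B\<rparr>)" "y \<in> carrier (A\<lparr>carrier := B\<rparr>)"
    then show "bracket (A\<lparr>carrier := B\<rparr>) (xs[i := x \<oplus>\<^bsub>A\<lparr>carrier := B\<rparr>\<^esub> y]) =
      bracket (A\<lparr>carrier := B\<rparr>) (xs[i := x]) \<oplus>\<^bsub>A\<lparr>carrier := B\<rparr>\<^esub> bracket (A\<lparr>carrier := B\<rparr>) (xs[i := y])"
      using bracket_add[of xs i x y] B'(1) by auto
  next
    fix xs :: "'a list" and i c x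
    assume "length xs = n" "set xs \<subseteq> carrier (A\<lparr>carrier := B\<rparr>)" "i < n"
      "c \<in> carrier F" "x \<in> carrier (A\<lparr>carrier := B\<rparr>)"
    then show "bracket (A\<lparr>carrier := B\<rparr>) (xs[i := c \<odot>\<^bsub>A\<lparr>carrier := B\<rparr>\<^esub> x]) =
      c \<odot>\<^bsub>A\<lparr>carrier := B\<rparr>\<^esub> bracket (A\<lparr>carrier := B\<rparr>) (xs[i := x])"
      using bracket_smult[of xs i c x] B'(1) by auto
  next
    fix xs :: "'a list" and \<sigma>
    assume xs: "length xs = n" "set xs \<subseteq> carrier (A\<lparr>carrier := B\<rparr>)" "\<sigma> permutes {..<n}"
    then have p: "bracket A (permute_list \<sigma> xs) \<in> B"
      by (intro B') auto
    have "bracket A xs = [sign \<sigma>] \<cdot>\<^bsub>A\<^esub> bracket A (permute_list \<sigma> xs)"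
      using bracket_skew[of xs \<sigma>] xs B'(1) by auto
    then show "bracket (A\<lparr>carrier := B\<rparr>) xs =
      [sign \<sigma>] \<cdot>\<^bsub>A\<lparr>carrier := B\<rparr>\<^esub> bracket (A\<lparr>carrier := B\<rparr>) (permute_list \<sigma> xs)"
      using p B'(1) by (subst B.add_pow_sign) (auto simp: add_pow_sign)
  next
    fix xs ys :: "'a list"
    assume xs: "length xs = n" "set xs \<subseteq> carrier (A\<lparr>carrier := B\<rparr>)"
      and ys: "length ys = n - 1" "set ys \<subseteq> carrier (A\<lparr>carrier := B\<rparr>)"
    have "bracket A (xs[i := bracket A (xs ! i # ys)]) \<in> B" if "i < n" for i
      using xs ys arity that by (intro B' upd) auto
    then show "bracket (A\<lparr>carrier := B\<rparr>) (bracket (A\<lparr>carrier := B\<rparr>) xs # ys) =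
      (\<Oplus>\<^bsub>A\<lparr>carrier := B\<rparr>\<^esub>i\<in>{..<n}. bracket (A\<lparr>carrier := B\<rparr>)
         (xs[i := bracket (A\<lparr>carrier := B\<rparr>) (xs ! i # ys)]))"
      using bracket_derivation[of xs ys] xs ys B'(1) by (subst fs) auto
  qed (use B' in auto)
qed

lemma subalgebra_of_subalgebra_iff:
  assumes B: "nLie_subalgebra n F A B"
  shows "nLie_subalgebra n F (A\<lparr>carrier := B\<rparr>) C \<longleftrightarrow> C \<subseteq> B \<and> nLie_subalgebra n F A C"
proof -
  interpret B: nLie_algebra n F "A\<lparr>carrier := B\<rparr>" by (rule subalgebra_is_nLie_algebra[OF B])
  show ?thesis
    using subalgebraD(1)[OF B]
    unfolding nLie_subalgebra_def B.subspace_iff subspace_iff by auto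
qed

lemma maximal_subalgebra_absorbs:
  assumes "nLie_maximal_subalgebra n F A M" "nLie_subalgebra n F A B" "M \<subseteq> B" "B \<noteq> carrier A"
  shows "B = M"
  using assms unfolding nLie_maximal_subalgebra_def by blast

text \<open>
  An ideal is only required to absorb the bracket in the first entry; swapping entry \<open>i\<close> with the
  first one costs a sign.
\<close>

lemma bracket_entry_in_ideal:
  assumes I: "nLie_ideal n F A I" and xs: "length xs = n" "set xs \<subseteq> carrier A"
    and i: "i < n" "xs ! i \<in> I"
  shows "bracket A xs \<in> I"
proof -
  let ?\<tau> = "transpose 0 i"
  have perm: "?\<tau> permutes {..<n}" using i by (intro permutes_swap_id) auto
  let ?ys = "permute_list ?\<tau> xs"
  have len: "length ?ys = n" "set ?ys \<subseteq> carrier A" using xs perm by auto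
  then obtain y ys where ys: "?ys = y # ys" using arity by (cases ?ys) auto
  have "y = ?ys ! 0" by (simp add: ys)
  also have "\<dots> = xs ! i" using perm xs i arity by (subst permute_list_nth) auto
  finally have "bracket A ?ys \<in> I"
    using i len ys by (auto intro!: idealD(5)[OF I])
  then show ?thesis
    using bracket_skew[OF xs perm] idealD(1,4)[OF I] by (auto simp: add_pow_sign)
qed

lemma sum_of_ideals:
  assumes I: "nLie_ideal n F A I" and J: "nLie_ideal n F A J"
  shows "nLie_ideal n F A (subspace_sum I J)"
proof -
  have sub: "subspace F (subspace_sum I J) A"
    using I J by (intro sum_is_subspace) (auto simp: nLie_ideal_def)
  have "bracket A ((x \<oplus>\<^bsub>A\<^esub> y) # zs) \<in> subspace_sum I J"
    if "x \<in> I" "y \<in> J" "length zs = n - 1" "set zs \<subseteq> carrier A" for x y zs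
  proof -
    have "bracket A ((x \<oplus>\<^bsub>A\<^esub> y) # zs) = bracket A (x # zs) \<oplus>\<^bsub>A\<^esub> bracket A (y # zs)"
      using bracket_add[of "x # zs" 0 x y] that arity idealD(1)[OF I] idealD(1)[OF J] by auto
    moreover have "bracket A (x # zs) \<in> I" "bracket A (y # zs) \<in> J"
      using that I J by (auto intro: idealD(5))
    ultimately show ?thesis by (auto simp: submodule_sum_def)
  qed
  then show ?thesis
    using sub by (auto simp: nLie_ideal_def submodule_sum_def)
qed

section \<open>The Frattini ideal\<close>

lemma Frattini_subalgebra_subspace: "subspace F (Frattini_subalgebra n F A) A"
proof -
  have "nLie_subalgebra n F A M" if "nLie_maximal_subalgebra n F A M" for M
    using that by (simp add: nLie_maximal_subalgebra_def)
  note M = subalgebraD[OF this]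
  show ?thesis
    unfolding subspace_iff Frattini_subalgebra_def by (auto intro: M)
qed

text \<open>
  The union of all ideals inside the Frattini subalgebra is closed under addition, because the sum
  of two such ideals is again one. It is therefore the greatest, in any dimension.
\<close>

lemma Frattini_ideal_is_greatest:
  shows Frattini_ideal_is_ideal: "nLie_ideal n F A (Frattini_ideal n F A)"
    and Frattini_ideal_subset: "Frattini_ideal n F A \<subseteq> Frattini_subalgebra n F A"
    and Frattini_idealI:
      "\<And>J. \<lbrakk>nLie_ideal n F A J; J \<subseteq> Frattini_subalgebra n F A\<rbrakk> \<Longrightarrow> J \<subseteq> Frattini_ideal n F A"
proof -
  let ?P = "\<lambda>I. nLie_ideal n F A I \<and> I \<subseteq> Frattini_subalgebra n F A"
  define U where "U = \<Union> {I. ?P I}"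
  have zero: "?P {\<zero>\<^bsub>A\<^esub>}"
  proof
    show "nLie_ideal n F A {\<zero>\<^bsub>A\<^esub>}"
    proof (rule idealI)
      fix x :: 'a and ys :: "'a list"
      assume "x \<in> {\<zero>\<^bsub>A\<^esub>}" "length ys = n - 1" "set ys \<subseteq> carrier A"
      moreover from this have "bracket A (\<zero>\<^bsub>A\<^esub> # ys) \<in> carrier A"
        using arity by (intro bracket_closed) auto
      ultimately show "bracket A (x # ys) \<in> {\<zero>\<^bsub>A\<^esub>}"
        using bracket_smult[of "\<zero>\<^bsub>A\<^esub> # ys" 0 "\<zero>\<^bsub>F\<^esub>" "\<zero>\<^bsub>A\<^esub>"] arity by auto
    qed auto
    show "{\<zero>\<^bsub>A\<^esub>} \<subseteq> Frattini_subalgebra n F A"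
      using Frattini_subalgebra_subspace by (auto simp: subspace_iff)
  qed
  have sum: "?P (subspace_sum I J)" if "?P I" "?P J" for I J
    using that sum_of_ideals vsum_is_minimal[of I J "Frattini_subalgebra n F A"]
      Frattini_subalgebra_subspace by (auto simp: nLie_ideal_def)
  have PU: "?P U"
  proof
    show "nLie_ideal n F A U"
    proof (rule idealI)
      fix x y assume "x \<in> U" "y \<in> U"
      then obtain I J where "?P I" "?P J" "x \<in> I" "y \<in> J" by (auto simp: U_def)
      moreover from this have "x \<oplus>\<^bsub>A\<^esub> y \<in> subspace_sum I J"
        by (auto simp: submodule_sum_def)
      ultimately show "x \<oplus>\<^bsub>A\<^esub> y \<in> U" using sum unfolding U_def by blast
    next
      show "\<zero>\<^bsub>A\<^esub> \<in> U" using zero unfolding U_def by blast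
    next
      fix x ys assume "x \<in> U" "length ys = n - 1" "set ys \<subseteq> carrier A"
      then show "bracket A (x # ys) \<in> U" unfolding U_def using idealD(5) by blast
    qed (auto simp: U_def dest: idealD)
    show "U \<subseteq> Frattini_subalgebra n F A" by (auto simp: U_def)
  qed
  moreover have "I \<subseteq> U" if "?P I" for I using that by (auto simp: U_def)
  ultimately have eq: "Frattini_ideal n F A = U"
    unfolding Frattini_ideal_def by (intro Greatest_equality) auto
  show "nLie_ideal n F A (Frattini_ideal n F A)"
    "Frattini_ideal n F A \<subseteq> Frattini_subalgebra n F A" using PU eq by auto
  show "\<And>J. \<lbrakk>nLie_ideal n F A J; J \<subseteq> Frattini_subalgebra n F A\<rbrakk> \<Longrightarrow> J \<subseteq> Frattini_ideal n F A"
    unfolding eq by (auto simp: U_def)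
qed

end

section \<open>Epimorphisms\<close>

text \<open>
  The target \<open>L\<close> is a bare structure here: its being an n-Lie algebra follows from surjectivity, and
  this is how the quotient gets its axioms. For the same reason \<open>f\<close> is assumed to preserve zero, which
  does not follow from additivity before \<open>L\<close> is known to be a group.
\<close>

locale nLie_epimorphism = nLie_algebra n F A
  for n :: nat and F :: "('f, 'k) ring_scheme" and A :: "('f, 'a, 'm) nLie_scheme"
    and L :: "('f, 'b, 'l) nLie_scheme" and f :: "'a \<Rightarrow> 'b" +
  assumes onto: "f ` carrier A = carrier L"
    and f_add: "\<lbrakk>x \<in> carrier A; y \<in> carrier A\<rbrakk> \<Longrightarrow> f (x \<oplus>\<^bsub>A\<^esub> y) = f x \<oplus>\<^bsub>L\<^esub> f y"
    and f_zero: "f \<zero>\<^bsub>A\<^esub> = \<zero>\<^bsub>L\<^esub>"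
    and f_smult: "\<lbrakk>c \<in> carrier F; x \<in> carrier A\<rbrakk> \<Longrightarrow> f (c \<odot>\<^bsub>A\<^esub> x) = c \<odot>\<^bsub>L\<^esub> f x"
    and f_bracket: "\<lbrakk>length xs = n; set xs \<subseteq> carrier A\<rbrakk> \<Longrightarrow> f (bracket A xs) = bracket L (map f xs)"
begin

lemma list_lift:
  assumes "set Xs \<subseteq> f ` B"
  obtains xs where "set xs \<subseteq> B" "Xs = map f xs" "length xs = length Xs"
proof -
  have "\<exists>xs. set xs \<subseteq> B \<and> Xs = map f xs" using assms
  proof (induction Xs)
    case (Cons X Xs)
    then obtain x xs where "x \<in> B" "X = f x" "set xs \<subseteq> B" "Xs = map f xs" by auto
    then show ?case by (intro exI[of _ "x # xs"]) auto
  qed auto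
  then show ?thesis using that by auto
qed

lemma carrier_lift:
  assumes "X \<in> carrier L"
  obtains x where "x \<in> carrier A" "X = f x"
  using assms unfolding onto[symmetric] by blast

lemma carrier_list_lift:
  assumes "set Xs \<subseteq> carrier L"
  obtains xs where "set xs \<subseteq> carrier A" "Xs = map f xs" "length xs = length Xs"
  using assms unfolding onto[symmetric] by (rule list_lift)

text \<open>
  For each axiom, lift the elements of \<open>L\<close> to \<open>A\<close>, use the axiom there and apply \<open>f\<close>; the image of a
  negative is a negative.
\<close>

lemma image_is_nLie_algebra: "nLie_algebra n F L"
proof -
  have "module F L"
  proof (rule module_criteria)
    show "\<forall>v\<in>carrier L. \<exists>w\<in>carrier L. v \<oplus>\<^bsub>L\<^esub> w = \<zero>\<^bsub>L\<^esub>"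
      unfolding onto[symmetric] using f_add f_zero M.r_neg M.a_inv_closed by fastforce
    show "cring F" by (rule R.cring_axioms)
  qed (auto simp: onto[symmetric] f_add[symmetric] f_smult[symmetric] f_zero[symmetric]
         M.a_ac smult_assoc1 smult_l_distr smult_r_distr)
  then interpret L: vectorspace F L
    by (intro vectorspace.intro field_axioms)
  have closed: "f x \<in> carrier L" if "x \<in> carrier A" for x using that onto by blast
  have upd: "set (xs[i := x]) \<subseteq> carrier A" if "set xs \<subseteq> carrier A" "x \<in> carrier A" for xs i x
    using that set_update_subset_insert[of xs i x] by blast
  show ?thesis
  proof
    show "n \<ge> 2" by (rule arity)
  next
    fix Xs :: "'b list" assume Xs: "length Xs = n" "set Xs \<subseteq> carrier L"
    obtain xs where xs: "length xs = n" "set xs \<subseteq> carrier A" "Xs = map f xs"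
      using carrier_list_lift[OF Xs(2)] Xs(1) by metis
    show "bracket L Xs \<in> carrier L"
      unfolding xs(3) f_bracket[OF xs(1,2), symmetric] by (rule closed[OF bracket_closed[OF xs(1,2)]])
  next
    fix Xs :: "'b list" and i X Y
    assume Xs: "length Xs = n" "set Xs \<subseteq> carrier L" "i < n"
      and XY: "X \<in> carrier L" "Y \<in> carrier L"
    obtain xs where xs: "length xs = n" "set xs \<subseteq> carrier A" "Xs = map f xs"
      using carrier_list_lift[OF Xs(2)] Xs(1) by metis
    obtain x where x: "x \<in> carrier A" "X = f x" by (rule carrier_lift[OF XY(1)])
    obtain y where y: "y \<in> carrier A" "Y = f y" by (rule carrier_lift[OF XY(2)])
    have "f (bracket A (xs[i := x \<oplus>\<^bsub>A\<^esub> y])) = f (bracket A (xs[i := x]) \<oplus>\<^bsub>A\<^esub> bracket A (xs[i := y]))"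
      by (rule arg_cong[OF bracket_add[OF xs(1,2) Xs(3) x(1) y(1)]])
    then show "bracket L (Xs[i := X \<oplus>\<^bsub>L\<^esub> Y]) = bracket L (Xs[i := X]) \<oplus>\<^bsub>L\<^esub> bracket L (Xs[i := Y])"
      unfolding xs(3) x(2) y(2)
      by (simp add: map_update f_add f_bracket bracket_closed upd xs(1,2) x(1) y(1))
  next
    fix Xs :: "'b list" and i c X
    assume Xs: "length Xs = n" "set Xs \<subseteq> carrier L" "i < n"
      and c: "c \<in> carrier F" and X: "X \<in> carrier L"
    obtain xs where xs: "length xs = n" "set xs \<subseteq> carrier A" "Xs = map f xs"
      using carrier_list_lift[OF Xs(2)] Xs(1) by metis
    obtain x where x: "x \<in> carrier A" "X = f x" by (rule carrier_lift[OF X])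
    have "f (bracket A (xs[i := c \<odot>\<^bsub>A\<^esub> x])) = f (c \<odot>\<^bsub>A\<^esub> bracket A (xs[i := x]))"
      by (rule arg_cong[OF bracket_smult[OF xs(1,2) Xs(3) c x(1)]])
    then show "bracket L (Xs[i := c \<odot>\<^bsub>L\<^esub> X]) = c \<odot>\<^bsub>L\<^esub> bracket L (Xs[i := X])"
      unfolding xs(3) x(2)
      by (simp add: map_update f_smult f_bracket bracket_closed upd xs(1,2) x(1) c)
  next
    fix Xs :: "'b list" and \<sigma>
    assume Xs: "length Xs = n" "set Xs \<subseteq> carrier L" and s: "\<sigma> permutes {..<n}"
    then obtain xs where xs: "length xs = n" "set xs \<subseteq> carrier A" "Xs = map f xs"
      using carrier_list_lift[OF Xs(2)] by metis
    have p: "length (permute_list \<sigma> xs) = n" "set (permute_list \<sigma> xs) \<subseteq> carrier A"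
      using xs s by auto
    have Xp: "permute_list \<sigma> Xs = map f (permute_list \<sigma> xs)"
      using xs s by (simp add: permute_list_map)
    show "bracket L Xs = [sign \<sigma>] \<cdot>\<^bsub>L\<^esub> bracket L (permute_list \<sigma> Xs)"
      unfolding Xp unfolding f_bracket[OF p, symmetric] xs(3) f_bracket[OF xs(1,2), symmetric]
        bracket_skew[OF xs(1,2) s] add_pow_sign[OF bracket_closed[OF p]]
        L.add_pow_sign[OF closed[OF bracket_closed[OF p]]]
      by (intro f_smult bracket_closed p) simp
  next
    fix Xs Ys :: "'b list"
    assume Xs: "length Xs = n" "set Xs \<subseteq> carrier L"
      and Ys: "length Ys = n - 1" "set Ys \<subseteq> carrier L"
    obtain xs where xs: "length xs = n" "set xs \<subseteq> carrier A" "Xs = map f xs"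
      using carrier_list_lift[OF Xs(2)] Xs(1) by metis
    obtain ys where ys: "length ys = n - 1" "set ys \<subseteq> carrier A" "Ys = map f ys"
      using carrier_list_lift[OF Ys(2)] Ys(1) by metis
    have nth_xs: "xs ! i \<in> carrier A" if "i < n" for i
      using xs(1,2) nth_mem[of i xs] that by blast
    have inner: "bracket A (xs ! i # ys) \<in> carrier A"
      "bracket L (Xs ! i # Ys) = f (bracket A (xs ! i # ys))" if "i < n" for i
      using xs ys that arity f_bracket[of "xs ! i # ys"] bracket_closed[of "xs ! i # ys"]
        nth_xs[OF that] by auto
    have outer: "bracket A (xs[i := bracket A (xs ! i # ys)]) \<in> carrier A"
      "bracket L (Xs[i := bracket L (Xs ! i # Ys)]) = f (bracket A (xs[i := bracket A (xs ! i # ys)]))"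
      if "i < n" for i
      using inner[OF that] xs upd
        f_bracket[of "xs[i := bracket A (xs ! i # ys)]"]
        bracket_closed[of "xs[i := bracket A (xs ! i # ys)]"] by (simp_all add: map_update)
    have "bracket L (bracket L Xs # Ys) = f (bracket A (bracket A xs # ys))"
      using xs ys arity f_bracket[of "bracket A xs # ys"] f_bracket[of xs] bracket_closed by auto
    also have "\<dots> = f (\<Oplus>\<^bsub>A\<^esub>i\<in>{..<n}. bracket A (xs[i := bracket A (xs ! i # ys)]))"
      using bracket_derivation[OF xs(1,2) ys(1,2)] by simp
    also have "\<dots> = (\<Oplus>\<^bsub>L\<^esub>i\<in>{..<n}. f (bracket A (xs[i := bracket A (xs ! i # ys)])))"
      using outer closed f_add f_zero
      by (intro finsum_additive_image M.abelian_monoid_axioms L.abelian_monoid_axioms) auto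
    also have "\<dots> = (\<Oplus>\<^bsub>L\<^esub>i\<in>{..<n}. bracket L (Xs[i := bracket L (Xs ! i # Ys)]))"
      using outer closed by (intro L.finsum_cong') auto
    finally show "bracket L (bracket L Xs # Ys) =
      (\<Oplus>\<^bsub>L\<^esub>i\<in>{..<n}. bracket L (Xs[i := bracket L (Xs ! i # Ys)]))" .
  qed
qed

sublocale L: nLie_algebra n F L
  by (rule image_is_nLie_algebra)

definition preimage :: "'b set \<Rightarrow> 'a set" where
  "preimage X = {x \<in> carrier A. f x \<in> X}"

lemma image_preimage: "X \<subseteq> carrier L \<Longrightarrow> f ` preimage X = X"
  unfolding preimage_def onto[symmetric] by auto

lemma subset_preimage_image: "B \<subseteq> carrier A \<Longrightarrow> B \<subseteq> preimage (f ` B)"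
  unfolding preimage_def by auto

lemma preimage_subalgebra:
  assumes "nLie_subalgebra n F L X"
  shows "nLie_subalgebra n F A (preimage X)"
proof (rule subalgebraI)
  fix xs assume xs: "length xs = n" "set xs \<subseteq> preimage X"
  then have "bracket L (map f xs) \<in> X"
    by (intro L.subalgebraD(5)[OF assms]) (auto simp: preimage_def)
  moreover have "set xs \<subseteq> carrier A" using xs by (auto simp: preimage_def)
  ultimately show "bracket A xs \<in> preimage X"
    using xs(1) f_bracket[of xs] bracket_closed[of xs] by (auto simp: preimage_def)
qed (use L.subalgebraD[OF assms] in \<open>auto simp: preimage_def f_add f_zero f_smult\<close>)

lemma image_subalgebra:
  assumes "nLie_subalgebra n F A B"
  shows "nLie_subalgebra n F L (f ` B)"
proof -
  note B = subalgebraD[OF assms]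
  have BA: "x \<in> carrier A" if "x \<in> B" for x using that B(1) by blast
  show ?thesis
  proof (rule L.subalgebraI)
    show "f ` B \<subseteq> carrier L" using B(1) onto by blast
    show "\<zero>\<^bsub>L\<^esub> \<in> f ` B" using B(2) f_zero by (metis imageI)
  next
    fix Xs assume "length Xs = n" "set Xs \<subseteq> f ` B"
    then obtain xs where "length xs = n" "set xs \<subseteq> B" "Xs = map f xs"
      using list_lift[of Xs B] by metis
    then show "bracket L Xs \<in> f ` B"
      using f_bracket[of xs] B by (metis imageI order_trans)
  qed (auto simp: f_add[symmetric] f_smult[symmetric] BA intro!: imageI B)
qed

lemma preimage_ideal:
  assumes "nLie_ideal n F L J"
  shows "nLie_ideal n F A (preimage J)"
proof (rule idealI)
  fix x ys assume xs: "x \<in> preimage J" "length ys = n - 1" "set ys \<subseteq> carrier A"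
  then have "bracket L (f x # map f ys) \<in> J"
    using onto by (intro L.idealD(5)[OF assms]) (auto simp: preimage_def)
  then show "bracket A (x # ys) \<in> preimage J"
    using xs arity f_bracket[of "x # ys"] bracket_closed[of "x # ys"] by (auto simp: preimage_def)
qed (use L.idealD[OF assms] in \<open>auto simp: preimage_def f_add f_zero f_smult\<close>)

lemma image_ideal:
  assumes "nLie_ideal n F A I"
  shows "nLie_ideal n F L (f ` I)"
proof -
  note I = idealD[OF assms]
  have IA: "x \<in> carrier A" if "x \<in> I" for x using that I(1) by blast
  show ?thesis
  proof (rule L.idealI)
    show "f ` I \<subseteq> carrier L" using I(1) onto by blast
    show "\<zero>\<^bsub>L\<^esub> \<in> f ` I" using I(2) f_zero by (metis imageI)
  next
    fix X Ys assume X: "X \<in> f ` I" and Ys: "length Ys = n - 1" "set Ys \<subseteq> carrier L"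
    obtain x where x: "x \<in> I" "X = f x" using X by blast
    moreover obtain ys where ys: "length ys = n - 1" "set ys \<subseteq> carrier A" "Ys = map f ys"
      using carrier_list_lift[OF Ys(2)] Ys(1) by metis
    ultimately show "bracket L (X # Ys) \<in> f ` I"
      using f_bracket[of "x # ys"] imageI[OF I(5)[OF x(1) ys(1,2)], of f] IA arity by simp
  qed (auto simp: f_add[symmetric] f_smult[symmetric] IA intro!: imageI I)
qed

lemma restrict_epimorphism:
  assumes B: "nLie_subalgebra n F A B"
  shows "nLie_epimorphism n F (A\<lparr>carrier := B\<rparr>) (L\<lparr>carrier := f ` B\<rparr>) f"
proof -
  interpret B: nLie_algebra n F "A\<lparr>carrier := B\<rparr>" by (rule subalgebra_is_nLie_algebra[OF B])
  have BA: "x \<in> carrier A" if "x \<in> B" for x using that subalgebraD(1)[OF B] by blast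
  show ?thesis
    by unfold_locales (auto simp: f_add f_zero f_smult BA intro!: f_bracket)
qed

text \<open>
  A subalgebra \<open>B\<close> properly containing the preimage of \<open>M\<close> has an image properly containing \<open>M\<close>,
  hence maps onto \<open>L\<close>; as \<open>B\<close> also contains the kernel, it is all of \<open>A\<close>.
\<close>

lemma preimage_maximal:
  assumes M: "nLie_maximal_subalgebra n F L M"
  shows "nLie_maximal_subalgebra n F A (preimage M)"
proof -
  have sub: "nLie_subalgebra n F L M" and ne: "M \<noteq> carrier L"
    using M by (auto simp: nLie_maximal_subalgebra_def)
  have "M \<subset> carrier L" using L.subalgebraD(1)[OF sub] ne by blast
  have "B = carrier A" if B: "nLie_subalgebra n F A B" and lt: "preimage M \<subset> B" for B
  proof -
    obtain b where b: "b \<in> B" "f b \<notin> M"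
      using lt subalgebraD(1)[OF B] unfolding preimage_def by blast
    have "M \<subseteq> f ` B"
      using image_preimage[of M] \<open>M \<subset> carrier L\<close> lt by blast
    then have fB: "f ` B = carrier L"
      using L.maximal_subalgebra_absorbs[OF M image_subalgebra[OF B]] b by blast
    \<comment> \<open>\<open>x \<in> A\<close> differs from some \<open>y \<in> B\<close> by an element of the kernel, which lies in \<open>preimage M\<close>.\<close>
    show ?thesis
    proof
      show "carrier A \<subseteq> B"
      proof
        fix x assume x: "x \<in> carrier A"
        then obtain y where y: "y \<in> B" "f x = f y" using fB onto by blast
        then have yA: "y \<in> carrier A" using subalgebraD(1)[OF B] by blast
        have "f (x \<oplus>\<^bsub>A\<^esub> \<ominus>\<^bsub>A\<^esub> y) = f (y \<oplus>\<^bsub>A\<^esub> \<ominus>\<^bsub>A\<^esub> y)"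
          using x y yA by (simp add: f_add)
        also have "\<dots> = \<zero>\<^bsub>L\<^esub>" using yA f_zero by (simp add: M.r_neg)
        finally have "x \<oplus>\<^bsub>A\<^esub> \<ominus>\<^bsub>A\<^esub> y \<in> preimage M"
          using x yA L.subalgebraD(2)[OF sub] by (simp add: preimage_def)
        then have "x \<oplus>\<^bsub>A\<^esub> \<ominus>\<^bsub>A\<^esub> y \<in> B" using lt by blast
        then have "(x \<oplus>\<^bsub>A\<^esub> \<ominus>\<^bsub>A\<^esub> y) \<oplus>\<^bsub>A\<^esub> y \<in> B" using y subalgebraD(3)[OF B] by blast
        then show "x \<in> B" using x yA by (simp add: M.a_assoc M.l_neg)
      qed
    qed (rule subalgebraD(1)[OF B])
  qed
  moreover have "preimage M \<noteq> carrier A"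
    using image_preimage[of M] \<open>M \<subset> carrier L\<close> onto by auto
  ultimately show ?thesis
    using preimage_subalgebra[OF sub] by (auto simp: nLie_maximal_subalgebra_def)
qed

lemma image_Frattini_ideal: "f ` Frattini_ideal n F A \<subseteq> Frattini_ideal n F L"
proof (rule L.Frattini_idealI)
  show "nLie_ideal n F L (f ` Frattini_ideal n F A)"
    by (rule image_ideal[OF Frattini_ideal_is_ideal])
  show "f ` Frattini_ideal n F A \<subseteq> Frattini_subalgebra n F L"
    using Frattini_ideal_subset preimage_maximal onto
    unfolding Frattini_subalgebra_def preimage_def by blast
qed

text \<open>
  The image of a maximal \<open>M\<close> is a proper subalgebra by hypothesis, so its preimage is a proper
  subalgebra containing \<open>M\<close> and must be \<open>M\<close> itself. In particular \<open>M\<close> contains the kernel. A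
  subalgebra of \<open>L\<close> properly above the image pulls back to one properly above \<open>M\<close>.
\<close>

lemma image_maximal_if_essential:
  assumes essential: "\<And>B. \<lbrakk>nLie_subalgebra n F A B; f ` B = carrier L\<rbrakk> \<Longrightarrow> B = carrier A"
    and M: "nLie_maximal_subalgebra n F A M"
  shows "nLie_maximal_subalgebra n F L (f ` M)" and "preimage (f ` M) = M"
proof -
  have sub: "nLie_subalgebra n F A M" and ne: "M \<noteq> carrier A"
    using M by (auto simp: nLie_maximal_subalgebra_def)
  have fM: "nLie_subalgebra n F L (f ` M)" by (rule image_subalgebra[OF sub])
  have fne: "f ` M \<noteq> carrier L" using essential[OF sub] ne by blast
  have "X = carrier L" if X: "nLie_subalgebra n F L X" and lt: "f ` M \<subset> X" for X
  proof -
    have "M \<subseteq> preimage X"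
      using subalgebraD(1)[OF sub] lt by (auto simp: preimage_def)
    moreover have "preimage X \<noteq> M"
      using image_preimage[OF L.subalgebraD(1)[OF X]] lt by blast
    ultimately have "preimage X = carrier A"
      using maximal_subalgebra_absorbs[OF M preimage_subalgebra[OF X]] by blast
    then show ?thesis
      using image_preimage[OF L.subalgebraD(1)[OF X]] onto by simp
  qed
  then show "nLie_maximal_subalgebra n F L (f ` M)"
    using fM fne by (auto simp: nLie_maximal_subalgebra_def)
  have "preimage (f ` M) \<noteq> carrier A"
    using image_preimage[OF L.subalgebraD(1)[OF fM]] onto fne by auto
  then show "preimage (f ` M) = M"
    using maximal_subalgebra_absorbs[OF M preimage_subalgebra[OF fM]]
      subset_preimage_image[OF subalgebraD(1)[OF sub]] by blast
qed

text \<open>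
  The hypothesis cannot be dropped: the whole kernel lies in the left-hand side, while the map from
  a nonzero abelian algebra to zero has \<open>\<Phi>(A) = 0\<close>. It forces every maximal subalgebra of \<open>A\<close> to be
  the preimage of a maximal subalgebra of \<open>L\<close>.
\<close>

lemma preimage_Frattini_ideal_if_essential:
  assumes essential: "\<And>B. \<lbrakk>nLie_subalgebra n F A B; f ` B = carrier L\<rbrakk> \<Longrightarrow> B = carrier A"
  shows "preimage (Frattini_ideal n F L) \<subseteq> Frattini_ideal n F A"
proof (rule Frattini_idealI)
  show "nLie_ideal n F A (preimage (Frattini_ideal n F L))"
    by (rule preimage_ideal[OF L.Frattini_ideal_is_ideal])
  have "preimage (Frattini_ideal n F L) \<subseteq> M" if M: "nLie_maximal_subalgebra n F A M" for M
  proof -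
    have "Frattini_ideal n F L \<subseteq> f ` M"
      using L.Frattini_ideal_subset image_maximal_if_essential(1)[OF essential M]
      unfolding Frattini_subalgebra_def by blast
    then show ?thesis
      using image_maximal_if_essential(2)[OF essential M] unfolding preimage_def by blast
  qed
  then show "preimage (Frattini_ideal n F L) \<subseteq> Frattini_subalgebra n F A"
    unfolding Frattini_subalgebra_def by (auto simp: preimage_def)
qed

end

section \<open>The quotient map\<close>

lemma listset_iff:
  "xs \<in> listset As \<longleftrightarrow> length xs = length As \<and> (\<forall>i<length As. xs ! i \<in> As ! i)"
proof (induction As arbitrary: xs)
  case (Cons B As)
  then show ?case
    by (cases xs) (auto simp: set_Cons_def nth_Cons split: nat.splits)
qed auto

text \<open>
  The bracket is well defined modulo an ideal. The entries of \<open>xs\<close> are replaced by those of \<open>ys\<close> one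
  at a time, from the left; each replacement changes the bracket by a bracket with an entry in the
  ideal.
\<close>

lemma (in nLie_algebra) bracket_congruent:
  assumes I: "nLie_ideal n F A I"
    and xs: "length xs = n" "set xs \<subseteq> carrier A" and ys: "length ys = n" "set ys \<subseteq> carrier A"
    and diff: "\<And>i. i < n \<Longrightarrow> ys ! i \<in> I +>\<^bsub>A\<^esub> xs ! i"
  shows "bracket A ys \<in> I +>\<^bsub>A\<^esub> bracket A xs"
proof -
  note I' = idealD[OF I]
  have "bracket A (take k ys @ drop k xs) \<in> I +>\<^bsub>A\<^esub> bracket A xs" if "k \<le> n" for k
    using that
  proof (induction k)
    case 0
    have "\<zero>\<^bsub>A\<^esub> \<oplus>\<^bsub>A\<^esub> bracket A xs \<in> I +>\<^bsub>A\<^esub> bracket A xs"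
      using I' xs bracket_closed by (intro M.a_rcosI) auto
    then show ?case using bracket_closed[OF xs] by simp
  next
    case (Suc k)
    then have k: "k < n" by simp
    obtain d where d: "d \<in> I" "ys ! k = d \<oplus>\<^bsub>A\<^esub> xs ! k"
      using diff[OF k] unfolding a_r_coset_def' by blast
    let ?zs = "take k ys @ drop k xs"
    have zs: "length ?zs = n" "set ?zs \<subseteq> carrier A"
      using xs ys k set_take_subset[of k ys] set_drop_subset[of k xs] by auto
    have xk: "xs ! k \<in> carrier A" using xs k by auto
    have dA: "d \<in> carrier A" using d I' by blast
    have "take (Suc k) ys @ drop (Suc k) xs = ?zs[k := ys ! k]"
      using xs ys k by (auto simp: list_eq_iff_nth_eq nth_append nth_list_update)
    moreover have "?zs[k := xs ! k] = ?zs"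
      using xs ys k by (auto simp: list_eq_iff_nth_eq nth_append nth_list_update)
    ultimately have step: "bracket A (take (Suc k) ys @ drop (Suc k) xs) =
        bracket A (?zs[k := d]) \<oplus>\<^bsub>A\<^esub> bracket A ?zs"
      using bracket_add[OF zs k dA xk] d by simp
    have "set (?zs[k := d]) \<subseteq> carrier A"
      using set_update_subset_insert[of ?zs k d] zs dA by blast
    then have e: "bracket A (?zs[k := d]) \<in> I"
      using zs k d by (intro bracket_entry_in_ideal[OF I, of _ k]) auto
    obtain h where h: "h \<in> I" "bracket A ?zs = h \<oplus>\<^bsub>A\<^esub> bracket A xs"
      using Suc unfolding a_r_coset_def' by auto
    have "bracket A (take (Suc k) ys @ drop (Suc k) xs) =
        (bracket A (?zs[k := d]) \<oplus>\<^bsub>A\<^esub> h) \<oplus>\<^bsub>A\<^esub> bracket A xs"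
      unfolding step h(2) using e h(1) I'(1) bracket_closed[OF xs] by (subst M.a_assoc) auto
    then show ?case
      using M.a_rcosI[OF I'(3)[OF e h(1)] I'(1) bracket_closed[OF xs]] by simp
  qed
  from this[of n] show ?thesis using xs ys by simp
qed

lemma (in nLie_algebra) ideal_abelian_subgroup:
  assumes I: "nLie_ideal n F A I"
  shows "abelian_subgroup I A"
proof (rule abelian_subgroupI3)
  note I' = idealD[OF I]
  have "\<ominus>\<^bsub>A\<^esub> x \<in> I" if "x \<in> I" for x
    using that I'(1) I'(4)[of "\<ominus>\<^bsub>F\<^esub> \<one>\<^bsub>F\<^esub>" x] smult_l_minus[of "\<one>\<^bsub>F\<^esub>" x] by auto
  then show "additive_subgroup I A"
    using I' by (intro additive_subgroupI M.add.subgroupI) (auto simp: a_inv_def)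
qed (rule M.abelian_group_axioms)

lemma (in nLie_algebra) quotient_epimorphism:
  assumes I: "nLie_ideal n F A I"
  shows "nLie_epimorphism n F A (nLie_quotient A I) (\<lambda>x. I +>\<^bsub>A\<^esub> x)"
proof -
  interpret I: abelian_subgroup I A by (rule ideal_abelian_subgroup[OF I])
  note I' = idealD[OF I]
  have coset_eq: "I +>\<^bsub>A\<^esub> y = I +>\<^bsub>A\<^esub> x" if "y \<in> I +>\<^bsub>A\<^esub> x" "x \<in> carrier A" for x y
    using that M.a_repr_independence I.a_subgroup by metis
  have coset_carrier: "y \<in> carrier A" if "y \<in> I +>\<^bsub>A\<^esub> x" "x \<in> carrier A" for x y
    using that M.a_r_coset_subset_G I'(1) by blast
  show ?thesis
  proof
    show "(\<lambda>x. I +>\<^bsub>A\<^esub> x) ` carrier A = carrier (nLie_quotient A I)"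
      by (auto simp: nLie_quotient_def A_RCOSETS_def')
    show "I +>\<^bsub>A\<^esub> \<zero>\<^bsub>A\<^esub> = \<zero>\<^bsub>nLie_quotient A I\<^esub>"
      using I' by (simp add: nLie_quotient_def)
  next
    fix x y assume "x \<in> carrier A" "y \<in> carrier A"
    then show "I +>\<^bsub>A\<^esub> (x \<oplus>\<^bsub>A\<^esub> y) = (I +>\<^bsub>A\<^esub> x) \<oplus>\<^bsub>nLie_quotient A I\<^esub> (I +>\<^bsub>A\<^esub> y)"
      by (simp add: nLie_quotient_def I.a_rcos_sum)
  next
    fix c x assume c: "c \<in> carrier F" and x: "x \<in> carrier A"
    have "I +>\<^bsub>A\<^esub> (c \<odot>\<^bsub>A\<^esub> y) = I +>\<^bsub>A\<^esub> (c \<odot>\<^bsub>A\<^esub> x)" if "y \<in> I +>\<^bsub>A\<^esub> x" for y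
    proof (rule coset_eq)
      obtain d where d: "d \<in> I" "y = d \<oplus>\<^bsub>A\<^esub> x" using \<open>y \<in> I +>\<^bsub>A\<^esub> x\<close> unfolding a_r_coset_def' by blast
      then have "c \<odot>\<^bsub>A\<^esub> y = c \<odot>\<^bsub>A\<^esub> d \<oplus>\<^bsub>A\<^esub> c \<odot>\<^bsub>A\<^esub> x"
        using c x I'(1) by (auto intro: smult_r_distr)
      then show "c \<odot>\<^bsub>A\<^esub> y \<in> I +>\<^bsub>A\<^esub> (c \<odot>\<^bsub>A\<^esub> x)"
        using I' c x d by (auto intro!: M.a_rcosI)
    qed (use c x in simp)
    then have "(\<Union>y\<in>I +>\<^bsub>A\<^esub> x. I +>\<^bsub>A\<^esub> (c \<odot>\<^bsub>A\<^esub> y)) = I +>\<^bsub>A\<^esub> (c \<odot>\<^bsub>A\<^esub> x)"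
      using I.a_rcos_self[OF x] by (intro SUP_eq_const) blast+
    then show "I +>\<^bsub>A\<^esub> (c \<odot>\<^bsub>A\<^esub> x) = c \<odot>\<^bsub>nLie_quotient A I\<^esub> (I +>\<^bsub>A\<^esub> x)"
      by (simp add: nLie_quotient_def)
  next
    fix xs assume xs: "length xs = n" "set xs \<subseteq> carrier A"
    let ?Xs = "map (\<lambda>x. I +>\<^bsub>A\<^esub> x) xs"
    have "I +>\<^bsub>A\<^esub> bracket A ys = I +>\<^bsub>A\<^esub> bracket A xs" if "ys \<in> listset ?Xs" for ys
    proof (rule coset_eq)
      have ys: "length ys = n" "\<And>i. i < n \<Longrightarrow> ys ! i \<in> I +>\<^bsub>A\<^esub> xs ! i"
        using that xs by (auto simp: listset_iff)
      have "ys ! i \<in> carrier A" if "i < n" for i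
        using coset_carrier[OF ys(2)[OF that]] xs nth_mem[of i xs] that by blast
      then have "set ys \<subseteq> carrier A" using ys(1) by (auto simp: in_set_conv_nth)
      then show "bracket A ys \<in> I +>\<^bsub>A\<^esub> bracket A xs"
        using ys by (intro bracket_congruent[OF I xs])
    qed (rule bracket_closed[OF xs])
    moreover have "xs \<in> listset ?Xs"
      using xs I.a_rcos_self by (auto simp: listset_iff subset_iff)
    ultimately have "(\<Union>ys\<in>listset ?Xs. I +>\<^bsub>A\<^esub> bracket A ys) = I +>\<^bsub>A\<^esub> bracket A xs"
      by (intro SUP_eq_const) blast+
    then show "I +>\<^bsub>A\<^esub> bracket A xs = bracket (nLie_quotient A I) ?Xs"
      by (simp add: nLie_quotient_def)
  qed
qed

section \<open>E-algebras and elementary quotients\<close>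

theorem theorem3p7:
  fixes F :: "('f, 'k) ring_scheme" and A :: "('f, 'a, 'm) nLie_scheme" and n :: nat
  assumes "field_characteristic_zero F"
    and "nLie_algebra n F A"
    and "vectorspace.fin_dim F A"
  shows "nLie_E_algebra n F A \<longleftrightarrow>
    nLie_elementary n F (nLie_quotient A (Frattini_ideal n F A))"
proof -
  interpret nLie_algebra n F A by (rule assms(2))
  define I where "I = Frattini_ideal n F A"
  define Q where "Q = nLie_quotient A I"
  define \<pi> where "\<pi> = (\<lambda>x. I +>\<^bsub>A\<^esub> x)"
  have I: "nLie_ideal n F A I" unfolding I_def by (rule Frattini_ideal_is_ideal)
  interpret I: abelian_subgroup I A by (rule ideal_abelian_subgroup[OF I])
  interpret \<pi>: nLie_epimorphism n F A Q \<pi>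
    unfolding Q_def \<pi>_def by (rule quotient_epimorphism[OF I])
  have Q_zero: "\<zero>\<^bsub>Q\<^esub> = I" by (simp add: Q_def nLie_quotient_def)
  have ker: "\<pi> x = I \<longleftrightarrow> x \<in> I" if "x \<in> carrier A" for x
    unfolding \<pi>_def using that M.a_coset_join1 M.a_coset_join2 I.a_subgroup by metis
  have "nLie_elementary n F Q" if E: "nLie_E_algebra n F A"
    unfolding nLie_elementary_def
  proof (intro conjI allI impI)
    show "nLie_algebra n F Q" by (rule \<pi>.image_is_nLie_algebra)
    fix C assume C: "nLie_subalgebra n F Q C"
    define \<D> where "\<D> = {D. nLie_subalgebra n F A D \<and> \<pi> ` D = C}"
    have "\<pi>.preimage C \<in> \<D>"
      using \<pi>.preimage_subalgebra[OF C] \<pi>.image_preimage[OF \<pi>.L.subalgebraD(1)[OF C]]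
      by (simp add: \<D>_def)
    moreover have "subspace F W A" if "W \<in> \<D>" for W
      using that by (simp add: \<D>_def nLie_subalgebra_def)
    ultimately obtain D where "D \<in> \<D>" and least: "\<And>D'. \<lbrakk>D' \<in> \<D>; D' \<subseteq> D\<rbrakk> \<Longrightarrow> D' = D"
      using minimal_subspace_exists[OF assms(3), of _ \<D>] by metis
    then have D: "nLie_subalgebra n F A D" and DC: "\<pi> ` D = C" by (auto simp: \<D>_def)
    interpret D: nLie_epimorphism n F "A\<lparr>carrier := D\<rparr>" "Q\<lparr>carrier := C\<rparr>" \<pi>
      using \<pi>.restrict_epimorphism[OF D] DC by simp
    \<comment> \<open>Minimality of \<open>D\<close> says that no proper subalgebra of \<open>D\<close> maps onto \<open>C\<close>.\<close>
    have "D.preimage (Frattini_ideal n F (Q\<lparr>carrier := C\<rparr>)) \<subseteq> Frattini_ideal n F (A\<lparr>carrier := D\<rparr>)"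
      using least by (intro D.preimage_Frattini_ideal_if_essential)
        (auto simp: \<D>_def subalgebra_of_subalgebra_iff[OF D])
    also have "\<dots> \<subseteq> I" using E D by (simp add: nLie_E_algebra_def I_def)
    finally have sub: "D.preimage (Frattini_ideal n F (Q\<lparr>carrier := C\<rparr>)) \<subseteq> I \<inter> D"
      by (auto simp: D.preimage_def)
    have "Frattini_ideal n F (Q\<lparr>carrier := C\<rparr>) =
        \<pi> ` D.preimage (Frattini_ideal n F (Q\<lparr>carrier := C\<rparr>))"
      by (rule D.image_preimage[OF D.L.idealD(1)[OF D.L.Frattini_ideal_is_ideal], symmetric])
    also have "\<dots> \<subseteq> \<pi> ` (I \<inter> D)" using sub by blast
    also have "\<dots> \<subseteq> {\<zero>\<^bsub>Q\<^esub>}"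
      using ker idealD(1)[OF I] Q_zero by auto
    finally show "Frattini_ideal n F (Q\<lparr>carrier := C\<rparr>) = {\<zero>\<^bsub>Q\<^esub>}"
      using D.L.idealD(2)[OF D.L.Frattini_ideal_is_ideal] by auto
  qed
  moreover have "nLie_E_algebra n F A" if el: "nLie_elementary n F Q"
    unfolding nLie_E_algebra_def
  proof (intro conjI allI impI)
    show "nLie_algebra n F A" by (rule assms(2))
    fix B assume B: "nLie_subalgebra n F A B"
    interpret B: nLie_epimorphism n F "A\<lparr>carrier := B\<rparr>" "Q\<lparr>carrier := \<pi> ` B\<rparr>" \<pi>
      by (rule \<pi>.restrict_epimorphism[OF B])
    have "\<pi> ` Frattini_ideal n F (A\<lparr>carrier := B\<rparr>) \<subseteq> {\<zero>\<^bsub>Q\<^esub>}"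
      using B.image_Frattini_ideal el \<pi>.image_subalgebra[OF B]
      by (auto simp: nLie_elementary_def)
    moreover have "Frattini_ideal n F (A\<lparr>carrier := B\<rparr>) \<subseteq> carrier A"
      using B.idealD(1)[OF B.Frattini_ideal_is_ideal] subalgebraD(1)[OF B] by auto
    ultimately show "Frattini_ideal n F (A\<lparr>carrier := B\<rparr>) \<subseteq> Frattini_ideal n F A"
      using ker Q_zero unfolding I_def[symmetric] by blast
  qed
  ultimately have "nLie_E_algebra n F A \<longleftrightarrow> nLie_elementary n F Q" by (rule iffI)
  then show ?thesis by (simp only: Q_def I_def)
qed

end
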